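(* Let $n$ and $k$ be positive integers. The equation $(k!)^n-k^{n!}=(n!)^k-n^{k!}$ holds if and only if $k=n$ or $(k,n)\in\{(1,2),(2,1)\}$. *)

theory Defs
  imports Main
begin

end

theory Submission
  imports Defs
begin

text \<open>
  The equation is symmetric in \<open>k\<close> and \<open>n\<close>, so let \<open>k < n\<close> and compare
  \<open>(k!)^n + n^(k!)\<close> with \<open>(n!)^k + k^(n!)\<close>. For \<open>k \<ge> 2\<close> each summand on the right
  dominates: \<open>(k!)^(n-k) \<le> (k^k)^(n-k)\<close> and \<open>n! \<ge> k! k^(n-k)\<close> give \<open>(k!)^n \<le> (n!)^k\<close>,
  while \<open>n! \<ge> n k!\<close> and \<open>k^n > n\<close> give \<open>n^(k!) < k^(n!)\<close>. For \<open>k = 1\<close> the equation is \<open>n = n!\<close>.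
\<close>

text \<open>Each of the \<open>n - k\<close> factors \<open>k + 1\<close>, ..., \<open>n\<close> of
  \<open>fact n\<close> beyond \<open>fact k\<close> is at least \<open>k\<close>.\<close>

lemma fact_times_power_le_fact:
  fixes k n :: nat
  assumes "k \<le> n"
  shows "fact k * k ^ (n - k) \<le> (fact n :: nat)"
  using assms
proof (induction n rule: dec_induct)
  case base
  then show ?case by simp
next
  case (step m)
  have "fact k * k ^ (Suc m - k) = k * (fact k * k ^ (m - k))"
    using step.hyps by (simp add: Suc_diff_le)
  also have "\<dots> \<le> Suc m * fact m"
    using step by (intro mult_mono) auto
  finally show ?case by simp
qed

lemma fact_power_le_fact_power:
  fixes k n :: nat
  assumes "k \<le> n"
  shows "(fact k :: nat) ^ n \<le> fact n ^ k"
proof -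
  have "(fact k :: nat) ^ n = fact k ^ k * fact k ^ (n - k)"
    using assms by (simp flip: power_add)
  also have "\<dots> \<le> fact k ^ k * (k ^ k) ^ (n - k)"
    using fact_le_power[of k, where 'a = nat] by (intro mult_left_mono power_mono) auto
  also have "\<dots> = (fact k * k ^ (n - k)) ^ k"
    by (simp add: power_mult_distrib mult.commute flip: power_mult)
  also have "\<dots> \<le> fact n ^ k"
    using fact_times_power_le_fact[OF assms] by (intro power_mono) auto
  finally show ?thesis .
qed

lemma power_fact_less_power_fact:
  fixes k n :: nat
  assumes "2 \<le> k" and "k < n"
  shows "n ^ (fact k :: nat) < k ^ (fact n :: nat)"
proof -
  have "n < k ^ n"
    using assms by (intro power_gt_expt) auto
  then have "n ^ (fact k :: nat) < (k ^ n) ^ (fact k :: nat)"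
    by (intro power_strict_mono) auto
  also have "\<dots> = k ^ (n * fact k)"
    by (simp add: power_mult)
  also have "\<dots> \<le> k ^ (fact n :: nat)"
  proof (rule power_increasing)
    have "n * fact k \<le> n * (fact (n - 1) :: nat)"
      using assms by (intro mult_left_mono fact_mono) auto
    also have "\<dots> = fact n"
      using assms by (simp add: fact_reduce)
    finally show "n * fact k \<le> (fact n :: nat)" .
  qed (use assms in auto)
  finally show ?thesis .
qed

text \<open>For \<open>n \<ge> 3\<close>, \<open>fact (n - 1) \<ge> n - 1 \<ge> 2\<close> makes
  \<open>fact n\<close> at least \<open>2 * n\<close>.\<close>

lemma fact_eq_self_imp_le_2:
  fixes n :: nat
  assumes "fact n = n"
  shows "n \<le> 2"
proof (rule ccontr)
  assume "\<not> n \<le> 2"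
  then have "n * 2 \<le> n * (fact (n - 1) :: nat)"
    using fact_ge_self[of "n - 1"] by (intro mult_left_mono) auto
  also have "\<dots> = n"
    using assms \<open>\<not> n \<le> 2\<close> by (simp add: fact_reduce)
  finally show False
    using \<open>\<not> n \<le> 2\<close> by simp
qed

lemma fact_power_diff_eq_imp:
  fixes k n :: nat
  assumes "0 < k" and "k < n"
    and eq: "(fact k :: int) ^ n - int k ^ (fact n :: nat) = (fact n :: int) ^ k - int n ^ (fact k :: nat)"
  shows "k = 1 \<and> n = 2"
proof -
  \<comment> \<open>Moving the subtracted powers across leaves only sums, so the equation descends
    to the naturals.\<close>
  have "int (fact k ^ n + n ^ (fact k :: nat)) = int (fact n ^ k + k ^ (fact n :: nat))"
    using eq by simp
  then have nat_eq: "fact k ^ n + n ^ (fact k :: nat) = fact n ^ k + k ^ (fact n :: nat)"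
    by (simp only: of_nat_eq_iff)
  have "\<not> 2 \<le> k"
    using nat_eq fact_power_le_fact_power[of k n] power_fact_less_power_fact[of k n] assms(2)
    by linarith
  then have "k = 1"
    using assms(1) by simp
  \<comment> \<open>At \<open>k = 1\<close>, \<open>nat_eq\<close> reads
    \<open>1 + n = fact n + 1\<close>.\<close>
  moreover have "n \<le> 2"
    using nat_eq \<open>k = 1\<close> by (intro fact_eq_self_imp_le_2) simp
  ultimately show ?thesis
    using assms(2) by simp
qed

theorem theorem1p3:
  fixes n k :: nat
  assumes "n > 0" and "k > 0"
  shows "(fact k :: int) ^ n - int k ^ (fact n :: nat) = (fact n :: int) ^ k - int n ^ (fact k :: nat)
    \<longleftrightarrow> k = n \<or> (k, n) \<in> {(1, 2), (2, 1)}"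
proof
  assume eq: "(fact k :: int) ^ n - int k ^ (fact n :: nat) = (fact n :: int) ^ k - int n ^ (fact k :: nat)"
  consider "k < n" | "k = n" | "n < k"
    by linarith
  \<comment> \<open>\<open>eq[symmetric]\<close> is \<open>eq\<close> with \<open>k\<close> and
    \<open>n\<close> exchanged, so one lemma settles both strict orders.\<close>
  then show "k = n \<or> (k, n) \<in> {(1, 2), (2, 1)}"
    using fact_power_diff_eq_imp[OF assms(2) _ eq] fact_power_diff_eq_imp[OF assms(1) _ eq[symmetric]]
    by cases auto
\<comment> \<open>For \<open>k\<close>, \<open>n\<close> equal to 1 and 2 in either order, both
  sides are 0.\<close>
qed (auto simp: fact_2)

end
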